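(* There exists a $D_3$-competitive deterministic online algorithm for chasing sets of cardinality at most $3$, where $D_3=2D_2+\sqrt{8+8D_2}+3=21+4\sqrt{5}$ with $D_2=9$ (i.e. $D_1=1$, $D_{k+1}=2D_k+\sqrt{8+8D_k}+3$).
   Context: Chasing small sets: a player moves in a metric space $(M,d)$, starting at $s_0\in M$. At each time $t=1,\dots,T$ a set $S_t\subseteq M$ with $1\le|S_t|\le k$ (here $k=3$) is revealed online, and the player must move to some $s_t\in S_t$, paying $d(s_{t-1},s_t)$; $T$ is not known in advance. An online algorithm is $\rho$-competitive if on every instance its total cost is at most $\rho\cdot\min\{\sum_{t=1}^T d(x_{t-1},x_t): x_0=s_0, x_t\in S_t\}$. *)

theory Defs
  imports "HOL-Analysis.Abstract_Metric_Spaces"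
begin

(* The value at 0 is a dummy: the recursion starts at index 1. *)
fun D :: "nat \<Rightarrow> real" where
  "D 0 = 0"
| "D (Suc 0) = 1"
| "D (Suc (Suc k)) = 2 * D (Suc k) + sqrt (8 + 8 * D (Suc k)) + 3"

(* The bound 1 \<le> card S also forces S to be finite. *)
definition requests :: "'a set \<Rightarrow> nat \<Rightarrow> 'a set list \<Rightarrow> bool" where
  "requests M k Ss \<longleftrightarrow> (\<forall>S\<in>set Ss. S \<subseteq> M \<and> 1 \<le> card S \<and> card S \<le> k)"

definition feasible :: "'a set list \<Rightarrow> 'a list \<Rightarrow> bool" where
  "feasible Ss xs \<longleftrightarrow> list_all2 (\<in>) xs Ss"

definition cost :: "('a \<Rightarrow> 'a \<Rightarrow> real) \<Rightarrow> 'a \<Rightarrow> 'a list \<Rightarrow> real" where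
  "cost d s0 xs = (\<Sum>t<length xs. d ((s0 # xs) ! t) (xs ! t))"

(* For request sequences as above the minimum ranges over a finite nonempty set. *)
definition opt :: "('a \<Rightarrow> 'a \<Rightarrow> real) \<Rightarrow> 'a \<Rightarrow> 'a set list \<Rightarrow> real" where
  "opt d s0 Ss = Min (cost d s0 ` {xs. feasible Ss xs})"

(* A deterministic online algorithm maps the starting point and the requests
   S_1, ..., S_t revealed so far to the position s_t; its own earlier positions
   are determined by this data. *)
type_synonym 'a strategy = "'a \<Rightarrow> 'a set list \<Rightarrow> 'a"

definition run :: "'a strategy \<Rightarrow> 'a \<Rightarrow> 'a set list \<Rightarrow> 'a list" where
  "run A s0 Ss = map (\<lambda>t. A s0 (take t Ss)) [1..<Suc (length Ss)]"

definition online_algorithm :: "'a set \<Rightarrow> nat \<Rightarrow> 'a strategy \<Rightarrow> bool" where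
  "online_algorithm M k A \<longleftrightarrow>
     (\<forall>s0\<in>M. \<forall>Ss. requests M k Ss \<longrightarrow> feasible Ss (run A s0 Ss))"

definition competitive ::
    "'a set \<Rightarrow> ('a \<Rightarrow> 'a \<Rightarrow> real) \<Rightarrow> nat \<Rightarrow> real \<Rightarrow> 'a strategy \<Rightarrow> bool" where
  "competitive M d k \<rho> A \<longleftrightarrow>
     (\<forall>s0\<in>M. \<forall>Ss. requests M k Ss \<longrightarrow>
        cost d s0 (run A s0 Ss) \<le> \<rho> * opt d s0 Ss)"

lemma finite_feasible:
  assumes "requests M k Ss"
  shows "finite {xs. feasible Ss xs}"
proof (rule finite_subset)
  have "finite S" if "S \<in> set Ss" for S
    using assms that unfolding requests_def by (metis card.infinite not_one_le_zero)
  then show "finite {xs. set xs \<subseteq> \<Union> (set Ss) \<and> length xs = length Ss}"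
    by (intro finite_lists_length_eq) auto
  show "{xs. feasible Ss xs} \<subseteq> {xs. set xs \<subseteq> \<Union> (set Ss) \<and> length xs = length Ss}"
    by (fastforce simp: feasible_def list_all2_conv_all_nth in_set_conv_nth)
qed

lemma feasible_nonempty:
  assumes "requests M k Ss"
  shows "{xs. feasible Ss xs} \<noteq> {}"
proof -
  have "S \<noteq> {}" if "S \<in> set Ss" for S
    using assms that unfolding requests_def by fastforce
  then have "feasible Ss (map (\<lambda>S. SOME x. x \<in> S) Ss)"
    by (auto simp: feasible_def list_all2_conv_all_nth some_in_eq)
  then show ?thesis by blast
qed

end

theory Submission imports Defs "HOL-Library.Multiset" begin

text \<open>
  Join every point of a request to the best predecessor in the preceding request. This turns the
  instance into a growing tree with at most three active leaves; the depth of a leaf is its work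
  function value, and tree distances bound distances in the space from above. Each step then
  decomposes into deaths of leaves, splittings of leaves (at no cost) and growth of single leaves.

  With two leaves at depths \<open>L + a\<close> and \<open>L + b\<close> the player follows a doubling-like rule, moving
  from one branch to the other when its own branch exceeds \<open>r = 1 + sqrt 5 / 5\<close> times the other.
  With three leaves, two of them share a subtree hanging at distance \<open>l\<close> from the branching point,
  while the third one is at distance \<open>m\<close>. Between the subtree and the third leaf
  the player uses the same rule, comparing \<open>m\<close> with the smaller depth in the subtree; within the
  subtree it moves when one branch is twice as long as the other, as in the 9-competitive strategy
  for sets of size two. Measured from the branching point, the invariant bounds the cost so far by
  the ratio times the depth on the player's side, and by \<open>9\<close> times the depth on the player's side
  plus \<open>10 r = 10 + 2 sqrt 5\<close> times the depth on the other side; the ratio is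
  \<open>9 + 10 r\<^sup>2 = 21 + 4 sqrt 5\<close>. When the player stays at the third leaf while the subtree has two
  leaves, the adversary can only force it to pay for the growth of \<open>m\<close> itself; the savings pay for
  the later return to a subtree with two leaves.
\<close>

section \<open>Arithmetic with multiples of \<open>sqrt 5\<close>\<close>

text \<open>Keeping the multiple by \<open>sqrt 5\<close> opaque makes all inequalities below linear.\<close>

definition sqrt5_times :: "real \<Rightarrow> real" where
  "sqrt5_times x = sqrt 5 * x"

lemma sqrt5_times_add [simp]: "sqrt5_times (x + y) = sqrt5_times x + sqrt5_times y"
  by (simp add: sqrt5_times_def algebra_simps)

declare add_divide_distrib [simp]

lemmas expand = sqrt5_times_add distrib_left add_divide_distrib

lemma sqrt5_times_0 [simp]: "sqrt5_times 0 = 0"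
  by (simp add: sqrt5_times_def)

text \<open>Rational bounds on \<open>sqrt 5\<close>, for the inequalities with slack in which
  multiples of \<open>sqrt 5\<close> meet rational multiples.\<close>

lemma sqrt5_times_bounds:
  assumes "0 \<le> x"
  shows "11 * x \<le> 5 * sqrt5_times x" "4 * sqrt5_times x \<le> 9 * x"
proof -
  have "11 / 5 \<le> sqrt 5"
    by (rule real_le_rsqrt) (simp add: power2_eq_square)
  moreover have "sqrt 5 \<le> 9 / 4"
    by (rule real_le_lsqrt) (simp_all add: power2_eq_square)
  ultimately have "11 / 5 * x \<le> sqrt 5 * x" "sqrt 5 * x \<le> 9 / 4 * x"
    using assms mult_right_mono by blast+
  then show "11 * x \<le> 5 * sqrt5_times x" "4 * sqrt5_times x \<le> 9 * x"
    unfolding sqrt5_times_def by auto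
qed

lemma sqrt5_times_mono: "x \<le> y \<Longrightarrow> sqrt5_times x \<le> sqrt5_times y"
  unfolding sqrt5_times_def by (intro mult_left_mono) auto

lemma sqrt5_times_nonneg: "0 \<le> x \<Longrightarrow> 0 \<le> sqrt5_times x"
  by (simp add: sqrt5_times_def)

text \<open>Since \<open>r = 1 + sqrt 5 / 5\<close> exceeds 1, \<open>r m \<le> t\<close> gives
  \<open>m \<le> r t\<close>: a player who moves at the threshold finds the balance condition
  satisfied at its new branch.\<close>

lemma threshold_swap:
  assumes "0 \<le> m" "m + sqrt5_times m / 5 \<le> t"
  shows "m \<le> t + sqrt5_times t / 5"
proof -
  have "m \<le> t" using assms sqrt5_times_nonneg[of m] by simp
  then show ?thesis using assms(1) sqrt5_times_nonneg[of t] by simp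
qed

text \<open>Multiplication by \<open>sqrt 5\<close> turns the threshold condition into a second
  linear fact. Together they give \<open>10 r a \<ge> 10 r^2 b = 12 b + 4 sqrt 5 b\<close>, so at
  the moment of a move \<open>9 b + 10 r a\<close> is at least the ratio \<open>9 + 10 r^2\<close>
  times \<open>b\<close>.\<close>

lemma sqrt5_times_threshold:
  assumes "b + sqrt5_times b / 5 \<le> a"
  shows "sqrt5_times b + b \<le> sqrt5_times a"
proof -
  have "sqrt5_times (b + sqrt5_times b / 5) = sqrt5_times b + b"
    by (simp add: sqrt5_times_def algebra_simps)
  then show ?thesis by (metis assms sqrt5_times_mono)
qed

text \<open>Both inequalities say \<open>a \<le> b / r\<close>, since \<open>1 / r = (5 - sqrt 5) / 4\<close>.\<close>

lemma sqrt5_times_small: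
  assumes "4 * a + sqrt5_times b \<le> 5 * b"
  shows "4 * sqrt5_times a + 5 * b \<le> 5 * sqrt5_times b"
proof -
  have "sqrt5_times (4 * a + sqrt5_times b) = 4 * sqrt5_times a + 5 * b"
    "sqrt5_times (5 * b) = 5 * sqrt5_times b"
    by (simp_all add: sqrt5_times_def algebra_simps)
  then show ?thesis using sqrt5_times_mono[OF assms] by simp
qed

text \<open>Pays for the move from \<open>x\<close> inside the subtree to the third leaf. By
  \<open>a \<le> 2 * b\<close>, both \<open>9 a + a\<close> (if \<open>a \<le> b\<close>) and
  \<open>4 b + a + a\<close> (otherwise) are at most \<open>10 min a b\<close>; the threshold then
  replaces \<open>10 (l + min a b)\<close> by \<open>10 r m\<close>. In the second part
  \<open>t\<close> is the depth of the subtree after the event.\<close>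

lemma leave_subtree:
  fixes a b l m B c t :: real
  assumes "a \<le> 2 * b" "l + min a b \<le> m + sqrt5_times m / 5"
    and "c \<le> B + 9 * l + 10 * m + 2 * sqrt5_times m + 9 * a"
    and "c \<le> B + 9 * l + 10 * m + 2 * sqrt5_times m + 4 * b + a"
  shows "c + (l + a + m) \<le> B + 21 * m + 4 * sqrt5_times m"
    and "l + min a b \<le> t \<Longrightarrow> m + sqrt5_times m / 5 \<le> t \<Longrightarrow>
      c + (l + a + m) \<le> B + 9 * m + 10 * t + 2 * sqrt5_times t"
proof -
  have c: "c + (l + a + m) \<le> B + 10 * l + 10 * min a b + 11 * m + 2 * sqrt5_times m"
    using assms(1,3,4) by (simp add: min_def)
  then show "c + (l + a + m) \<le> B + 21 * m + 4 * sqrt5_times m"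
    using assms(2) by linarith
  show "c + (l + a + m) \<le> B + 9 * m + 10 * t + 2 * sqrt5_times t"
    if "l + min a b \<le> t" "m + sqrt5_times m / 5 \<le> t"
    using c that(1) sqrt5_times_threshold[OF that(2)] by linarith
qed

section \<open>The invariant on trees with at most three leaves\<close>

context Metric_space
begin

text \<open>
  The first argument lists the active leaves with their depths, the second one is the position of
  the player and the third one the cost paid so far. In the rules with three leaves, \<open>x\<close> and \<open>y\<close> lie
  in the common subtree, whose root has depth \<open>L + l\<close>; the player is inside or outside of it.
  The coefficient \<open>18 + 18 / 5 sqrt 5\<close> of \<open>l\<close> is \<open>8 r + 10 r\<close>: a splitting of the other leaf at depth
  \<open>l\<close> turns \<open>9 m + 10 r l\<close> into \<open>m + 8 r l + 10 r l\<close>, as \<open>m \<le> r l\<close>.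
\<close>

inductive good :: "('a \<times> real) multiset \<Rightarrow> 'a \<Rightarrow> real \<Rightarrow> bool" where
  single: "\<lbrakk>x \<in> M; c \<le> 21 * h + 4 * sqrt5_times h\<rbrakk> \<Longrightarrow> good {#(x, h)#} x c"
| pair: "\<lbrakk>x \<in> M; y \<in> M; 0 \<le> a; 0 \<le> b; d x y \<le> a + b; u = L + a; v = L + b;
    a \<le> b + sqrt5_times b / 5;
    c \<le> 21 * L + 4 * sqrt5_times L + 21 * a + 4 * sqrt5_times a;
    c \<le> 21 * L + 4 * sqrt5_times L + 9 * a + 10 * b + 2 * sqrt5_times b\<rbrakk>
    \<Longrightarrow> good {#(x, u), (y, v)#} x c"
| inside: "\<lbrakk>x \<in> M; y \<in> M; z \<in> M; 0 \<le> a; 0 \<le> b; 0 \<le> l; 0 \<le> m;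
    d x y \<le> a + b; d x z \<le> l + a + m; d y z \<le> l + b + m;
    u = L + l + a; v = L + l + b; w = L + m;
    a \<le> 2 * b;
    l + min a b \<le> m + sqrt5_times m / 5;
    c \<le> 21 * L + 4 * sqrt5_times L + 21 * l + 4 * sqrt5_times l + 21 * a + 4 * sqrt5_times a;
    c \<le> 21 * L + 4 * sqrt5_times L + 21 * l + 4 * sqrt5_times l + a + 20 * b;
    c \<le> 21 * L + 4 * sqrt5_times L + 9 * l + 10 * m + 2 * sqrt5_times m + 9 * a;
    c \<le> 21 * L + 4 * sqrt5_times L + 9 * l + 10 * m + 2 * sqrt5_times m + 4 * b + a\<rbrakk>
    \<Longrightarrow> good {#(x, u), (y, v), (z, w)#} x c"
| outside: "\<lbrakk>x \<in> M; y \<in> M; z \<in> M; 0 \<le> a; a \<le> b; 0 \<le> l; 0 \<le> m;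
    d x y \<le> a + b; d x z \<le> l + a + m; d y z \<le> l + b + m;
    u = L + l + a; v = L + l + b; w = L + m;
    m \<le> l + a + sqrt5_times l / 5 + sqrt5_times a / 5;
    c \<le> 21 * L + 4 * sqrt5_times L + 21 * m + 4 * sqrt5_times m;
    c \<le> 21 * L + 4 * sqrt5_times L + 9 * m + 10 * l + 10 * a + 2 * sqrt5_times l + 2 * sqrt5_times a;
    c \<le> 21 * L + 4 * sqrt5_times L + m + 18 * l + 18 / 5 * sqrt5_times l + 20 * a;
    c \<le> 21 * L + 4 * sqrt5_times L + m + 18 * l + 18 / 5 * sqrt5_times l + 16 * b\<rbrakk>
    \<Longrightarrow> good {#(x, u), (y, v), (z, w)#} z c"

lemma good_mono: "good N p c \<Longrightarrow> c' \<le> c \<Longrightarrow> good N p c'"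
proof (induction rule: good.induct)
  case single then show ?case by (intro good.single) auto
next
  case (pair x y a b u L v c) then show ?case by (intro good.pair[of x y a b u L v]) auto
next
  case (inside x y z a b l m u L v w c)
  then show ?case by (intro good.inside[of x y z a b l m u L v w]) auto
next
  case (outside x y z a b l m u L v w c)
  then show ?case by (intro good.outside[of x y z a b l m u L v w]) auto
qed

lemma good_position: "good N p c \<Longrightarrow> p \<in> M \<and> p \<in> fst ` set_mset N"
  by (induction rule: good.induct) auto

text \<open>The optimum may end at any active leaf, so all of them are treated. The player's own
  leaf has its own bound in the invariant; for the others the balance conditions turn the mixed
  bounds into multiples of the other depth.\<close>

lemma good_ratio:
  assumes "good N p c" "(q, h) \<in># N"
  shows "c \<le> 21 * h + 4 * sqrt5_times h"
  using assms
proof (induction rule: good.induct)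
  case single then show ?case by auto
next
  case (pair x y a b u L v c)
  then show ?case using sqrt5_times_bounds[of a] sqrt5_times_bounds[of b] by auto
next
  case (inside x y z a b l m u L v w c)
  then show ?case using sqrt5_times_bounds[of a] sqrt5_times_bounds[of b]
      sqrt5_times_bounds[of l] sqrt5_times_bounds[of m]
    by (auto simp: min_def split: if_splits)
next
  case (outside x y z a b l m u L v w c)
  note bounds = sqrt5_times_bounds[OF \<open>0 \<le> a\<close>] sqrt5_times_bounds[OF \<open>0 \<le> l\<close>]
  have "c \<le> 21 * u + 4 * sqrt5_times u"
    using outside.hyps(4,6,14,17) bounds(1,3) unfolding \<open>u = _\<close> sqrt5_times_add by argo
  moreover have "21 * u + 4 * sqrt5_times u \<le> 21 * v + 4 * sqrt5_times v"
    using outside sqrt5_times_mono[OF \<open>a \<le> b\<close>] by simp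
  moreover have "c \<le> 21 * w + 4 * sqrt5_times w"
    using outside by simp
  ultimately show ?case using outside.prems by auto
qed

section \<open>Splitting, death and growth of a leaf\<close>

lemma mset2_cases:
  assumes "{#A, B#} = add_mset q N"
  obtains "q = A" "N = {#B#}" | "q = B" "N = {#A#}"
  using assms by (auto simp: add_eq_conv_ex)

lemma mset3_cases:
  assumes "{#A, B, C#} = add_mset q N"
  obtains "q = A" "N = {#B, C#}" | "q = B" "N = {#A, C#}" | "q = C" "N = {#A, B#}"
proof -
  have "q \<in># {#A, B, C#}" unfolding assms by simp
  moreover have "N = {#B, C#}" if "q = A" using assms that by simp
  moreover have "N = {#A, C#}" if "q = B" using assms that by (simp add: add_mset_commute[of A])
  moreover have "N = {#A, B#}" if "q = C" using assms that
    by (simp add: add_mset_commute[of A C] add_mset_commute[of B C])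
  ultimately show ?thesis using that by auto
qed

text \<open>The new subtree is rooted at the split leaf and has two branches of length 0. A pair
  becomes \<open>inside\<close> if the player stands at that leaf and \<open>outside\<close>
  otherwise.\<close>

lemma good_split:
  assumes "good (add_mset q N) p c" "size N \<le> 1"
  shows "good (add_mset q (add_mset q N)) p c"
  using assms(1,2)
proof (induction "add_mset q N" p c rule: good.induct)
  case (single x c h)
  then have "q = (x, h)" "N = {#}" by auto
  moreover have "good {#(x, h), (x, h)#} x c"
    using single by (intro good.pair[where L = h and a = 0 and b = 0]) auto
  ultimately show ?case by simp
next
  case (pair x y a b u L v c)
  from pair(11) show ?case
  proof (cases rule: mset2_cases)
    case 1
    have "good {#(x, u), (x, u), (y, v)#} x c"
      using pair by (intro good.inside[where L = L and l = a and m = b and a = 0 and b = 0]) auto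
    then show ?thesis using 1 pair by simp
  next
    case 2
    have "good {#(y, v), (y, v), (x, u)#} x c"
      using pair sqrt5_times_bounds[of b]
      by (intro good.outside[where L = L and l = b and m = a and a = 0 and b = 0])
       (auto simp: commute)
    then show ?thesis using 2 pair by (simp add: add_mset_commute)
  qed
next
  case (inside x y z a b l m u L v w c)
  then have "size (add_mset q N) = 3" by (metis size_add_mset size_empty numeral_3_eq_3)
  then show ?case using \<open>size N \<le> 1\<close> by simp
next
  case (outside x y z a b l m u L v w c)
  then have "size (add_mset q N) = 3" by (metis size_add_mset size_empty numeral_3_eq_3)
  then show ?case using \<open>size N \<le> 1\<close> by simp
qed

text \<open>The death of another leaf can also force a move: it changes the branching structure, and
  the balance condition of the remaining pair may fail. The player then goes to the other surviving
  leaf.\<close>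

lemma good_kill:
  assumes "good (add_mset q N) p c" "N \<noteq> {#}"
  shows "\<exists>p'. good N p' (c + d p p')"
  using assms(1,2)
proof (induction "add_mset q N" p c rule: good.induct)
  case (single x c h)
  then show ?case by simp
next
  case (pair x y a b u L v c)
  from pair(11) show ?case
  proof (cases rule: mset2_cases)
    case 1
    have "good N y (c + d x y)" unfolding 1
      using pair by (intro good.single) auto
    then show ?thesis by blast
  next
    case 2
    have "good N x (c + d x x)" unfolding 2
      using pair by (intro good.single) auto
    then show ?thesis by blast
  qed
next
  case (inside x y z a b l m u L v w c)
  let ?B = "21 * L + 4 * sqrt5_times L"
  note leave = leave_subtree[OF inside.hyps(14,15,18,19)]
  \<comment> \<open>The surviving leaf of the subtree is too deep compared with \<open>m\<close>, so
    the player goes to \<open>z\<close>.\<close>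
  have exit: "good {#(z, w), (x', L + l + e)#} z (c + d x z)"
    if t: "m + sqrt5_times m / 5 \<le> l + e" and e: "0 \<le> e" "min a b \<le> e"
      and x': "x' \<in> M" "d x' z \<le> l + e + m" for x' e
  proof (rule good.pair[where L = L and a = m and b = "l + e"])
    show "d z x' \<le> m + (l + e)" using x' by (simp add: commute)
    show "m \<le> l + e + sqrt5_times (l + e) / 5"
      by (rule threshold_swap[OF \<open>0 \<le> m\<close> t])
    show "c + d x z \<le> ?B + 21 * m + 4 * sqrt5_times m"
      using leave(1) inside.hyps(9) by linarith
    show "c + d x z \<le> ?B + 9 * m + 10 * (l + e) + 2 * sqrt5_times (l + e)"
      using leave(2)[OF _ t] e inside.hyps(9) by linarith
  qed (use inside.hyps x' e in auto)
  \<comment> \<open>Crossing to the sibling costs at most \<open>a + b\<close>; by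
    \<open>a \<le> 2 * b\<close>, \<open>2 a + 21 b \<le> 25 b\<close> and
    \<open>2 a + 5 b \<le> 9 b\<close>.\<close>
  have fin: "c + d x y \<le> ?B + 21 * l + 4 * sqrt5_times l + 25 * b"
      "c + d x y \<le> ?B + 9 * l + 10 * m + 2 * sqrt5_times m + 9 * b"
    using inside.hyps(8,14,17,19) by linarith+
  have lower: "11 * b \<le> 5 * sqrt5_times b" by (rule sqrt5_times_bounds[OF \<open>0 \<le> b\<close>])
  from inside.hyps(20) show ?case
  proof (cases rule: mset3_cases)
    case 1
    show ?thesis
    proof (cases "l + b \<le> m + sqrt5_times m / 5")
      case True
      have "good {#(y, v), (z, w)#} y (c + d x y)"
      proof (rule good.pair[where L = L and a = "l + b" and b = m])
        show "c + d x y \<le> ?B + 21 * (l + b) + 4 * sqrt5_times (l + b)"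
          using fin(1) lower \<open>0 \<le> b\<close> unfolding expand by linarith
        show "c + d x y \<le> ?B + 9 * (l + b) + 10 * m + 2 * sqrt5_times m"
          using fin(2) unfolding expand by linarith
      qed (use inside.hyps(1-13) True in auto)
      then show ?thesis using 1 by auto
    next
      case False
      then show ?thesis using exit[of b y] inside.hyps(2,5,10,12) 1 by (auto simp: add_mset_commute)
    qed
  next
    case 2
    show ?thesis
    proof (cases "l + a \<le> m + sqrt5_times m / 5")
      case True
      have "good {#(x, u), (z, w)#} x (c + d x x)"
        using inside.hyps(1-13,16,18) True
        by (intro good.pair[where L = L and a = "l + a" and b = m]) auto
      then show ?thesis using 2 by auto
    next
      case False
      then show ?thesis using exit[of a x] inside.hyps(1,4,9,11) 2 by (auto simp: add_mset_commute)
    qed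
  next
    case 3
    show ?thesis
    \<comment> \<open>The subtree alone is now a pair branching at \<open>L + l\<close>, and the
      threshold for pairs is stricter than the factor 2 used within the subtree.\<close>
    proof (cases "a \<le> b + sqrt5_times b / 5")
      case a: True
      have "good {#(x, u), (y, v)#} x (c + d x x)"
      proof (rule good.pair[where L = "L + l" and a = a and b = b])
        show "c + d x x \<le> 21 * (L + l) + 4 * sqrt5_times (L + l) + 9 * a + 10 * b + 2 * sqrt5_times b"
        \<comment> \<open>The cases meet at \<open>a = b / r\<close>. Above it
          \<open>a + 20 b\<close> is at most \<open>9 a + 10 r b\<close>; below it
          \<open>(9 + 10 r^2) a\<close> is.\<close>
        proof (cases "5 * b \<le> 4 * a + sqrt5_times b")
          case True
          then show ?thesis using inside.hyps(1,17) by simp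
        next
          case False
          then show ?thesis using inside.hyps(1,16) sqrt5_times_small[of a b] by simp
        qed
      qed (use inside.hyps(1-13,16) a in auto)
      then show ?thesis using 3 by auto
    next
      case False
      have "good {#(y, v), (x, u)#} y (c + d x y)"
      proof (rule good.pair[where L = "L + l" and a = b and b = a])
        show "c + d x y \<le> 21 * (L + l) + 4 * sqrt5_times (L + l) + 21 * b + 4 * sqrt5_times b"
          using fin(1) lower \<open>0 \<le> b\<close> unfolding expand by linarith
        have "b \<le> a" using False lower \<open>0 \<le> b\<close> by linarith
        then show "c + d x y \<le> 21 * (L + l) + 4 * sqrt5_times (L + l) + 9 * b + 10 * a + 2 * sqrt5_times a"
          using fin(1) lower \<open>0 \<le> b\<close> sqrt5_times_threshold[of b a] False
          unfolding expand by linarith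
        show "b \<le> a + sqrt5_times a / 5"
          using False \<open>0 \<le> b\<close> by (intro threshold_swap) auto
      qed (use inside.hyps(1-13) in \<open>auto simp: commute\<close>)
      then show ?thesis using 3 by (auto simp: add_mset_commute)
    qed
  qed
next
  case (outside x y z a b l m u L v w c)
  then have b: "0 \<le> b" by simp
  have ab: "sqrt5_times a \<le> sqrt5_times b" by (rule sqrt5_times_mono[OF \<open>a \<le> b\<close>])
  let ?B = "21 * L + 4 * sqrt5_times L"
  from outside.hyps(19) show ?case
  proof (cases rule: mset3_cases)
    case 1
    have "good {#(z, w), (y, v)#} z (c + d z z)"
      using outside.hyps(1-16) b ab by (intro good.pair[where L = L and a = m and b = "l + b"]) (auto simp: commute)
    then show ?thesis using 1 by (auto simp: add_mset_commute)
  next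
    case 2
    have "good {#(z, w), (x, u)#} z (c + d z z)"
      using outside.hyps(1-16) by (intro good.pair[where L = L and a = m and b = "l + a"]) (auto simp: commute)
    then show ?thesis using 2 by (auto simp: add_mset_commute)
  next
    case 3
    have "good {#(x, u), (y, v)#} x (c + d z x)"
    proof (rule good.pair[where L = "L + l" and a = a and b = b])
      \<comment> \<open>Inserting \<open>m \<le> r (l + a)\<close> makes the coefficient of
        \<open>l\<close> equal to \<open>18 r + 1 + 2 r\<close>, which is exactly the ratio
        \<open>21 + 4 sqrt 5\<close>.\<close>
      have c: "c + d z x \<le> ?B + 21 * l + 4 * sqrt5_times l + 2 / 5 * sqrt5_times a + 23 * a"
        "c + d z x \<le> ?B + 21 * l + 4 * sqrt5_times l + 2 / 5 * sqrt5_times a + 3 * a + 16 * b"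
        using outside.hyps(9,14,17,18) unfolding commute[of z x] expand by linarith+
      show "c + d z x \<le> 21 * (L + l) + 4 * sqrt5_times (L + l) + 21 * a + 4 * sqrt5_times a"
        using c(1) sqrt5_times_bounds(1)[OF \<open>0 \<le> a\<close>] \<open>0 \<le> a\<close> unfolding expand by linarith
      show "c + d z x \<le> 21 * (L + l) + 4 * sqrt5_times (L + l) + 9 * a + 10 * b + 2 * sqrt5_times b"
        using c sqrt5_times_bounds[OF \<open>0 \<le> a\<close>] \<open>0 \<le> a\<close> \<open>a \<le> b\<close> sqrt5_times_bounds(1)[OF b]
        unfolding expand by linarith
      show "a \<le> b + sqrt5_times b / 5" using \<open>a \<le> b\<close> sqrt5_times_nonneg[OF b] by simp
    qed (use outside.hyps(1-13) b in auto)
    then show ?thesis using 3 by auto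
  qed
qed

text \<open>The player follows the growth of its own leaf while the balance conditions persist.
  Otherwise it moves directly from its old position, so that the distance is bounded by the lengths
  before the growth. Growth of the sibling can also drive it out of the subtree, because the smaller
  depth there increases.\<close>

lemma good_grow:
  assumes "good (add_mset (q, h) N) p c" "r \<in> M"
  shows "\<exists>p'. good (add_mset (r, h + d q r) N) p' (c + d p p')"
  using assms(1)
proof (induction "add_mset (q, h) N" p c rule: good.induct)
  case (single x c g)
  then have "q = x" "h = g" "N = {#}" by auto
  moreover have "good {#(r, g + d x r)#} r (c + d x r)"
    using single assms(2) sqrt5_times_bounds[of "d x r"] by (intro good.single) auto
  ultimately show ?case by auto
next
  case (pair x y a b u L v c)
  define \<delta> where "\<delta> = d q r"
  have \<delta>: "0 \<le> \<delta>" by (simp add: \<delta>_def)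
  note bounds = sqrt5_times_bounds[OF \<open>0 \<le> a\<close>] sqrt5_times_bounds[OF \<open>0 \<le> b\<close>]
    sqrt5_times_bounds[OF \<delta>]
  from pair(11) show ?case unfolding \<delta>_def[symmetric]
  proof (cases rule: mset2_cases)
    case 1
    then have q: "q = x" "h = u" by auto
    have t: "d r y \<le> a + \<delta> + b"
      using triangle[of r x y] pair assms(2) q by (simp add: \<delta>_def commute)
    show "\<exists>p'. good (add_mset (r, h + \<delta>) N) p' (c + d x p')"
    proof (cases "a + \<delta> \<le> b + sqrt5_times b / 5")
      case True
      have "good {#(r, u + \<delta>), (y, v)#} r (c + \<delta>)"
        using pair assms(2) True t bounds \<delta>
        by (intro good.pair[where L = L and a = "a + \<delta>" and b = b]) auto
      then show ?thesis using 1 q by (auto simp: \<delta>_def)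
    next
      case False
      \<comment> \<open>By the old balance condition the cost after the move is, beyond the part
        from \<open>L\<close>, at most
        \<open>10 a + 11 b + 2 sqrt5_times b \<le> 21 b + 4 sqrt5_times b\<close>; \<open>*\<close>
        yields the mixed bound.\<close>
      have *: "sqrt5_times b + b \<le> sqrt5_times a + sqrt5_times \<delta>"
        using sqrt5_times_threshold[of b "a + \<delta>"] False by simp
      have "b \<le> a + \<delta> + sqrt5_times (a + \<delta>) / 5"
        using False pair.hyps(4) by (intro threshold_swap) auto
      then have "good {#(y, v), (r, u + \<delta>)#} y (c + d x y)"
        using pair assms(2) False t * \<delta>
        by (intro good.pair[where L = L and a = b and b = "a + \<delta>"]) (auto simp: commute)
      then show ?thesis using 1 q by (auto simp: add_mset_commute)
    qed
  next
    case 2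
    then have q: "q = y" "h = v" by auto
    have t: "d x r \<le> a + (b + \<delta>)"
      using triangle[of x y r] pair assms(2) q by (simp add: \<delta>_def commute)
    have "good {#(x, u), (r, v + \<delta>)#} x (c + d x x)"
      using pair assms(2) t bounds \<delta>
      by (intro good.pair[where L = L and a = a and b = "b + \<delta>"]) auto
    then show "\<exists>p'. good (add_mset (r, h + \<delta>) N) p' (c + d x p')"
      using 2 q by (auto simp: add_mset_commute)
  qed
next
  case (inside x y z a b l m u L v w c)
  define \<delta> where "\<delta> = d q r"
  have \<delta>: "0 \<le> \<delta>" by (simp add: \<delta>_def)
  let ?B = "21 * L + 4 * sqrt5_times L"
  note leave = leave_subtree[OF inside.hyps(14,15,18,19)]
  have exit: "good {#(x', L + l + a'), (y', L + l + b'), (z, w)#} z (c + d x z)"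
    if t: "m + sqrt5_times m / 5 \<le> l + a'"
      and e: "x' \<in> M" "y' \<in> M" "0 \<le> a'" "a' \<le> b'" "min a b \<le> a'" "max a b \<le> b'"
      "d x' y' \<le> a' + b'" "d x' z \<le> l + a' + m" "d y' z \<le> l + b' + m" for x' y' a' b'
  proof (rule good.outside[where L = L and a = a' and b = b' and l = l and m = m])
    have le: "c + d x z \<le> ?B + 10 * l + 11 * m + 2 * sqrt5_times m + 10 * a"
      "c + d x z \<le> ?B + 10 * l + 11 * m + 2 * sqrt5_times m + 4 * b + 2 * a"
      using inside.hyps(9,18,19) by linarith+
    have la: "0 \<le> l" "0 \<le> a'" "11 * l \<le> 5 * sqrt5_times l" "4 * sqrt5_times l \<le> 9 * l"
      using inside.hyps(6) e sqrt5_times_bounds by auto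
    show "m \<le> l + a' + sqrt5_times l / 5 + sqrt5_times a' / 5"
      using threshold_swap[OF \<open>0 \<le> m\<close> t] by simp
    show "c + d x z \<le> ?B + 21 * m + 4 * sqrt5_times m"
      using leave(1) inside.hyps(9) by linarith
    show "c + d x z \<le> ?B + 9 * m + 10 * l + 10 * a' + 2 * sqrt5_times l + 2 * sqrt5_times a'"
      using leave(2)[OF _ t] e(5) inside.hyps(9) by simp
    \<comment> \<open>Origin of the coefficients 20 and 16: the threshold turns
      \<open>10 m + 2 sqrt5_times m\<close> into at most \<open>10 l + 10 a'\<close>, and the rest
      adds at most \<open>10 a'\<close>, respectively \<open>2 b' + 4 b'\<close>. The resulting
      \<open>20 l\<close> is below \<open>18 l + 18 / 5 * sqrt5_times l\<close>.\<close>
    have "min a b \<le> a'" "10 * m + 2 * sqrt5_times m \<le> 10 * l + 10 * a'"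
      using e(5) t by auto
    moreover have "c + d x z \<le> ?B + 10 * l + 11 * m + 2 * sqrt5_times m + 10 * min a b"
      "c + d x z \<le> ?B + 10 * l + 11 * m + 2 * sqrt5_times m + 2 * min a b + 4 * max a b"
      using le inside.hyps(14) by (auto simp: min_def max_def)
    ultimately show "c + d x z \<le> ?B + m + 18 * l + 18 / 5 * sqrt5_times l + 20 * a'"
      "c + d x z \<le> ?B + m + 18 * l + 18 / 5 * sqrt5_times l + 16 * b'"
      using la e(4,6) by linarith+
  qed (use inside.hyps(1-13) e in auto)
  \<comment> \<open>The form \<open>outside\<close> lists the shallower branch first, so the
    branches are sorted here.\<close>
  have exit': "\<exists>p'. good {#(x', L + l + a'), (y', L + l + b'), (z, w)#} p' (c + d x p')"
    if "\<not> l + min a' b' \<le> m + sqrt5_times m / 5"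
      "x' \<in> M" "y' \<in> M" "a \<le> a'" "b \<le> b'"
      "d x' y' \<le> a' + b'" "d x' z \<le> l + a' + m" "d y' z \<le> l + b' + m" for x' y' a' b'
  proof (cases "a' \<le> b'")
    case True
    have "good {#(x', L + l + a'), (y', L + l + b'), (z, w)#} z (c + d x z)"
      by (rule exit) (use inside.hyps(4,5) that True in auto)
    then show ?thesis by blast
  next
    case False
    have "good {#(y', L + l + b'), (x', L + l + a'), (z, w)#} z (c + d x z)"
      by (rule exit) (use inside.hyps(4,5) that False in \<open>auto simp: commute\<close>)
    then show ?thesis by (auto simp: add_mset_commute)
  qed
  have s\<delta>: "0 \<le> sqrt5_times \<delta>" by (rule sqrt5_times_nonneg[OF \<delta>])
  from inside(20) show ?case unfolding \<delta>_def[symmetric]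
  proof (cases rule: mset3_cases)
    case 1
    then have q: "q = x" "h = u" by auto
    have t: "d r y \<le> a + \<delta> + b" "d r z \<le> l + (a + \<delta>) + m"
      using triangle[of r x y] triangle[of r x z] inside assms(2) q by (auto simp: \<delta>_def commute)
    show "\<exists>p'. good (add_mset (r, h + \<delta>) N) p' (c + d x p')"
    proof (cases "l + min (a + \<delta>) b \<le> m + sqrt5_times m / 5")
      case False
      show ?thesis using exit'[of "a + \<delta>" b r y] False inside.hyps(1-13) assms(2) t \<delta> 1 q
        by (auto simp: add.assoc)
    next
      case m: True
      show ?thesis
      proof (cases "a + \<delta> \<le> 2 * b")
        case True
        have "good {#(r, u + \<delta>), (y, v), (z, w)#} r (c + \<delta>)"
          using inside.hyps(1-13,16-19) assms(2) True m t s\<delta> \<delta>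
          by (intro good.inside[where L = L and l = l and m = m and a = "a + \<delta>" and b = b]) simp_all
        then show ?thesis using 1 q by (auto simp: \<delta>_def)
      next
        case False
        \<comment> \<open>The doubling move within the subtree:
          \<open>2 a + 5 b \<le> 9 b \<le> 4 (a + \<delta>) + b\<close> leaves no slack when
          \<open>a = 2 b\<close> and \<open>\<delta>\<close> tends to 0.\<close>
        have "good {#(y, v), (r, u + \<delta>), (z, w)#} y (c + d x y)"
        proof (rule good.inside[where L = L and l = l and m = m and a = b and b = "a + \<delta>"])
          have c: "c + d x y \<le> ?B + 21 * l + 4 * sqrt5_times l + 2 * a + 21 * b"
            "c + d x y \<le> ?B + 9 * l + 10 * m + 2 * sqrt5_times m + 2 * a + 5 * b"
            using inside.hyps(8,17,19) by linarith+
          show "c + d x y \<le> ?B + 21 * l + 4 * sqrt5_times l + 21 * b + 4 * sqrt5_times b"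
            using c(1) inside.hyps(5,14) sqrt5_times_bounds(1)[OF \<open>0 \<le> b\<close>] by linarith
          show "c + d x y \<le> ?B + 21 * l + 4 * sqrt5_times l + b + 20 * (a + \<delta>)"
            using c(1) inside.hyps(5,14) False \<delta> unfolding expand by linarith
          show "c + d x y \<le> ?B + 9 * l + 10 * m + 2 * sqrt5_times m + 9 * b"
            using c(2) inside.hyps(14) by linarith
          show "c + d x y \<le> ?B + 9 * l + 10 * m + 2 * sqrt5_times m + 4 * (a + \<delta>) + b"
            using c(2) inside.hyps(14) False \<delta> unfolding expand by linarith
        qed (use inside.hyps(1-13) assms(2) False m t \<delta> in \<open>auto simp: commute min.commute\<close>)
        then show ?thesis using 1 q by (auto simp: add_mset_commute)
      qed
    qed
  next
    case 2
    then have q: "q = y" "h = v" by auto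
    have t: "d x r \<le> a + (b + \<delta>)" "d r z \<le> l + (b + \<delta>) + m"
      using triangle[of x y r] triangle[of r y z] inside assms(2) q by (auto simp: \<delta>_def commute)
    show "\<exists>p'. good (add_mset (r, h + \<delta>) N) p' (c + d x p')"
    proof (cases "l + min a (b + \<delta>) \<le> m + sqrt5_times m / 5")
      case False
      show ?thesis using exit'[of a "b + \<delta>" x r] False inside.hyps(1-13) assms(2) t \<delta> 2 q
        by (auto simp: add.assoc add_mset_commute)
    next
      case True
      have "good {#(x, u), (r, v + \<delta>), (z, w)#} x (c + d x x)"
        using inside.hyps(1-14,16-19) assms(2) True t \<delta>
        by (intro good.inside[where L = L and l = l and m = m and a = a and b = "b + \<delta>"]) simp_all
      then show ?thesis using 2 q by (auto simp: add_mset_commute)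
    qed
  next
    case 3
    then have q: "q = z" "h = w" by auto
    have t: "d x r \<le> l + a + (m + \<delta>)" "d y r \<le> l + b + (m + \<delta>)"
      using triangle[of x z r] triangle[of y z r] inside assms(2) q by (auto simp: \<delta>_def commute)
    have "good {#(x, u), (y, v), (r, w + \<delta>)#} x (c + d x x)"
      using inside.hyps assms(2) t s\<delta> \<delta>
      by (intro good.inside[where L = L and l = l and m = "m + \<delta>" and a = a and b = b]) simp_all
    then show "\<exists>p'. good (add_mset (r, h + \<delta>) N) p' (c + d x p')"
      using 3 q by (auto simp: add_mset_commute)
  qed
next
  case (outside x y z a b l m u L v w c)
  then have b: "0 \<le> b" by simp
  define \<delta> where "\<delta> = d q r"
  have \<delta>: "0 \<le> \<delta>" by (simp add: \<delta>_def)
  have s\<delta>: "0 \<le> sqrt5_times \<delta>" by (rule sqrt5_times_nonneg[OF \<delta>])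
  have ab: "sqrt5_times a \<le> sqrt5_times b" by (rule sqrt5_times_mono[OF \<open>a \<le> b\<close>])
  from outside(19) show ?case unfolding \<delta>_def[symmetric]
  proof (cases rule: mset3_cases)
    case 1
    then have q: "q = x" "h = u" by auto
    have t: "d r y \<le> a + \<delta> + b" "d r z \<le> l + (a + \<delta>) + m"
      using triangle[of r x y] triangle[of r x z] outside assms(2) q by (auto simp: \<delta>_def commute)
    show "\<exists>p'. good (add_mset (r, h + \<delta>) N) p' (c + d z p')"
    \<comment> \<open>A deeper subtree only favours staying at \<open>z\<close>; the two branches
      are exchanged if the shallower one overtakes the other.\<close>
    proof (cases "a + \<delta> \<le> b")
      case True
      have "good {#(r, u + \<delta>), (y, v), (z, w)#} z (c + d z z)"
        using outside.hyps assms(2) True t s\<delta> \<delta>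
        by (intro good.outside[where L = L and l = l and m = m and a = "a + \<delta>" and b = b]) simp_all
      then show ?thesis using 1 q by auto
    next
      case False
      have "good {#(y, v), (r, u + \<delta>), (z, w)#} z (c + d z z)"
        using outside.hyps assms(2) False t ab \<delta> b
        by (intro good.outside[where L = L and l = l and m = m and a = b and b = "a + \<delta>"])
          (simp_all add: commute)
      then show ?thesis using 1 q by (auto simp: add_mset_commute)
    qed
  next
    case 2
    then have q: "q = y" "h = v" by auto
    have t: "d x r \<le> a + (b + \<delta>)" "d r z \<le> l + (b + \<delta>) + m"
      using triangle[of x y r] triangle[of r y z] outside assms(2) q by (auto simp: \<delta>_def commute)
    have "good {#(x, u), (r, v + \<delta>), (z, w)#} z (c + d z z)"
      using outside.hyps assms(2) t \<delta>
      by (intro good.outside[where L = L and l = l and m = m and a = a and b = "b + \<delta>"]) simp_all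
    then show "\<exists>p'. good (add_mset (r, h + \<delta>) N) p' (c + d z p')"
      using 2 q by (auto simp: add_mset_commute)
  next
    case 3
    then have q: "q = z" "h = w" by auto
    have t: "d x r \<le> l + a + (m + \<delta>)" "d y r \<le> l + b + (m + \<delta>)"
      using triangle[of x z r] triangle[of y z r] outside assms(2) q by (auto simp: \<delta>_def commute)
    show "\<exists>p'. good (add_mset (r, h + \<delta>) N) p' (c + d z p')"
    \<comment> \<open>The coefficient 1 of \<open>m\<close> in the last two bounds of
      \<open>outside\<close> pays exactly for following the growth. Past the threshold the player
      enters the subtree at its shallower leaf \<open>x\<close>.\<close>
    proof (cases "m + \<delta> \<le> l + a + sqrt5_times l / 5 + sqrt5_times a / 5")
      case True
      have "good {#(x, u), (y, v), (r, w + \<delta>)#} r (c + \<delta>)"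
        using outside.hyps assms(2) True t s\<delta> \<delta>
        by (intro good.outside[where L = L and l = l and m = "m + \<delta>" and a = a and b = b]) simp_all
      then show ?thesis using 3 q by (auto simp: add_mset_commute \<delta>_def)
    next
      case False
      let ?B = "21 * L + 4 * sqrt5_times L"
      have *: "sqrt5_times l + sqrt5_times a + (l + a) \<le> sqrt5_times m + sqrt5_times \<delta>"
        using sqrt5_times_threshold[of "l + a" "m + \<delta>"] False by simp
      have c: "c + d z x \<le> ?B + 2 * m + 19 * l + 18 / 5 * sqrt5_times l + 21 * a"
        "c + d z x \<le> ?B + 2 * m + 19 * l + 18 / 5 * sqrt5_times l + a + 16 * b"
        using outside.hyps(9,17,18) unfolding commute[of z x] by linarith+
      have c': "c + d z x \<le> ?B + 21 * l + 4 * sqrt5_times l + 23 * a + 2 / 5 * sqrt5_times a"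
        "c + d z x \<le> ?B + 21 * l + 4 * sqrt5_times l + 3 * a + 2 / 5 * sqrt5_times a + 16 * b"
        using c outside.hyps(14) by linarith+
      have lower: "11 * a \<le> 5 * sqrt5_times a" "4 * sqrt5_times a \<le> 9 * a"
        using outside.hyps(4) sqrt5_times_bounds by auto
      \<comment> \<open>The new mixed bound exceeds the ratio bound at \<open>l\<close> by at least
        \<open>12 a + 4 sqrt5_times a\<close>. The cost therefore exceeds the mixed bound without
        subtree terms by at most \<open>5 a\<close>, which fits under both \<open>9 a\<close> and
        \<open>4 b + a\<close>.\<close>
      have target: "?B + 21 * l + 4 * sqrt5_times l + 12 * a + 4 * sqrt5_times a \<le>
        ?B + 9 * l + 10 * (m + \<delta>) + 2 * sqrt5_times (m + \<delta>)"
        using * False unfolding expand by linarith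
      have five: "c + d z x \<le> ?B + 9 * l + 10 * (m + \<delta>) + 2 * sqrt5_times (m + \<delta>) + 5 * a"
        using c'(1) target lower \<open>0 \<le> a\<close> by linarith
      have "good {#(x, u), (y, v), (r, w + \<delta>)#} x (c + d z x)"
      proof (rule good.inside[where L = L and l = l and m = "m + \<delta>" and a = a and b = b])
        show "c + d z x \<le> ?B + 21 * l + 4 * sqrt5_times l + 21 * a + 4 * sqrt5_times a"
          using c'(1) lower \<open>0 \<le> a\<close> by linarith
        show "c + d z x \<le> ?B + 21 * l + 4 * sqrt5_times l + a + 20 * b"
          using c'(2) lower \<open>a \<le> b\<close> \<open>0 \<le> a\<close> by linarith
        show "c + d z x \<le> ?B + 9 * l + 10 * (m + \<delta>) + 2 * sqrt5_times (m + \<delta>) + 9 * a"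
          using five \<open>0 \<le> a\<close> by linarith
        show "c + d z x \<le> ?B + 9 * l + 10 * (m + \<delta>) + 2 * sqrt5_times (m + \<delta>) + 4 * b + a"
          using five \<open>a \<le> b\<close> by linarith
        have "l + a \<le> m + \<delta> + sqrt5_times (m + \<delta>) / 5"
          using False outside.hyps(4,6) by (intro threshold_swap) auto
        then show "l + min a b \<le> m + \<delta> + sqrt5_times (m + \<delta>) / 5"
          using \<open>a \<le> b\<close> by (simp add: min_def)
      qed (use outside.hyps(1-13) assms(2) t \<delta> b in auto)
      then show ?thesis using 3 q by (auto simp: add_mset_commute)
    qed
  qed
qed

section \<open>Processing a whole request\<close>

text \<open>The moves for single events are virtual: by the triangle inequality, going directly to
  the last position costs no more.\<close>

lemma good_chain:
  assumes "\<exists>p1. good N1 p1 (c + d p p1)" "p \<in> M"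
    and "\<And>p1 c1. good N1 p1 c1 \<Longrightarrow> \<exists>p2. good N2 p2 (c1 + d p1 p2)"
  shows "\<exists>p2. good N2 p2 (c + d p p2)"
proof -
  obtain p1 where p1: "good N1 p1 (c + d p p1)" using assms(1) by blast
  obtain p2 where p2: "good N2 p2 (c + d p p1 + d p1 p2)" using assms(3)[OF p1] by blast
  have "d p p2 \<le> d p p1 + d p1 p2"
    using triangle assms(2) good_position[OF p1] good_position[OF p2] by blast
  then have "good N2 p2 (c + d p p2)" by (intro good_mono[OF p2]) simp
  then show ?thesis by blast
qed

lemma good_stay: "good N p c \<Longrightarrow> \<exists>p'. good N p' (c + d p p')"
  using good_position[of N p c] by (intro exI[of _ p]) simp

lemma good_kill_many:
  assumes "good (K + N) p c" "N \<noteq> {#}"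
  shows "\<exists>p'. good N p' (c + d p p')"
  using assms(1)
proof (induction K arbitrary: p c)
  case empty
  then show ?case by (simp add: good_stay)
next
  case (add q K)
  show ?case
  proof (rule good_chain)
    show "\<exists>p1. good (K + N) p1 (c + d p p1)"
      using good_kill[of q "K + N" p c] add.prems assms(2) by simp
    show "p \<in> M" using good_position[OF add.prems] by blast
  qed (rule add.IH)
qed

lemma good_split_many:
  assumes "good N p c" "set_mset K \<subseteq> set_mset N" "size K + size N \<le> 3"
  shows "good (K + N) p c"
  using assms(2,3)
proof (induction K)
  case empty
  then show ?case using assms(1) by simp
next
  case (add q K)
  then have "good (K + N) p c" by simp
  moreover obtain N' where "N = add_mset q N'"
    using add.prems(1) multi_member_split[of q N] by auto
  ultimately show ?case
    using good_split[of q "K + N'" p c] add.prems(2) by simp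
qed

lemma good_grow_many:
  assumes "good (image_mset (\<lambda>y. (f y, h y)) U + N) p c" "set_mset U \<subseteq> M"
  shows "\<exists>p'. good (image_mset (\<lambda>y. (y, h y + d (f y) y)) U + N) p' (c + d p p')"
  using assms
proof (induction U arbitrary: N p c)
  case empty
  then show ?case by (simp add: good_stay)
next
  case (add y U)
  show ?case
  proof (rule good_chain)
    show "\<exists>p1. good (image_mset (\<lambda>y. (f y, h y)) U + add_mset (y, h y + d (f y) y) N) p1 (c + d p p1)"
      using good_grow[of "f y" "h y" _ p c y] add.prems by simp
    show "p \<in> M" using good_position[OF add.prems(1)] by blast
    show "\<exists>p2. good (image_mset (\<lambda>y. (y, h y + d (f y) y)) (add_mset y U) + N) p2 (c1 + d p1 p2)"
      if "good (image_mset (\<lambda>y. (f y, h y)) U + add_mset (y, h y + d (f y) y) N) p1 c1" for p1 c1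
      using add.IH[OF that] add.prems(2) by simp
  qed
qed

text \<open>In the multiset format of \<open>good\<close>, which has to admit several copies of a
  leaf that has just been split.\<close>

definition leaves :: "'a set \<Rightarrow> ('a \<Rightarrow> real) \<Rightarrow> ('a \<times> real) multiset" where
  "leaves S h = image_mset (\<lambda>x. (x, h x)) (mset_set S)"

text \<open>First the leaves without children die, then every other leaf splits into one copy per
  child, and finally each copy grows to its child. With the deaths first, splitting never leads to
  more than three leaves.\<close>

lemma good_next:
  assumes "good (leaves S h) p c" "finite S" "f ` S' \<subseteq> S"
    and "finite S'" "S' \<noteq> {}" "S' \<subseteq> M" "card S' \<le> 3"
  shows "\<exists>p'\<in>S'. good (leaves S' (\<lambda>y. h (f y) + d (f y) y)) p' (c + d p p')"
proof -
  define P where "P = f ` S'"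
  define A where "A = image_mset (\<lambda>y. (f y, h (f y))) (mset_set S')"
  have P: "finite P" "P \<noteq> {}" "P \<subseteq> S" using assms by (auto simp: P_def)
  have "mset_set S = mset_set (S - P) + mset_set P"
    using P assms(2) mset_set_Union[of "S - P" P]
    by (simp add: Diff_disjoint Int_commute Un_absorb2 finite_subset)
  then have 1: "\<exists>p1. good (leaves P h) p1 (c + d p p1)"
    using assms(1) P good_kill_many[of "leaves (S - P) h" "leaves P h" p c] by (simp add: leaves_def mset_set_empty_iff)
  have sub: "leaves P h \<subseteq># A"
  proof -
    have "mset_set P \<subseteq># image_mset f (mset_set S')"
      unfolding P_def using assms(4)
      by (metis finite_set_mset_mset_set mset_set_set_mset_msubset set_image_mset)
    from image_mset_subseteq_mono[OF this, of "\<lambda>x. (x, h x)"] show ?thesis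
      by (simp add: leaves_def A_def multiset.map_comp comp_def)
  qed
  have 2: "good A p1 c1" if "good (leaves P h) p1 c1" for p1 c1
  proof -
    have "good (A - leaves P h + leaves P h) p1 c1"
    proof (rule good_split_many[OF that])
      have "set_mset A \<subseteq> set_mset (leaves P h)"
        using assms(4) P(1) by (auto simp: A_def leaves_def P_def)
      then show "set_mset (A - leaves P h) \<subseteq> set_mset (leaves P h)"
        by (meson in_diffD subset_iff)
      show "size (A - leaves P h) + size (leaves P h) \<le> 3"
        unfolding size_union[symmetric] subset_mset.diff_add[OF sub] using assms(7) by (simp add: A_def)
    qed
    then show ?thesis using sub by simp
  qed
  have 3: "\<exists>p2. good (leaves S' (\<lambda>y. h (f y) + d (f y) y)) p2 (c1 + d p1 p2)" if "good A p1 c1" for p1 c1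
    using good_grow_many[of f "\<lambda>y. h (f y)" "mset_set S'" "{#}" p1 c1] that assms(4,6)
    by (simp add: A_def leaves_def)
  have "p \<in> M" using good_position[OF assms(1)] by blast
  from good_chain[OF 1 this 3[OF 2]] obtain p' where
    p': "good (leaves S' (\<lambda>y. h (f y) + d (f y) y)) p' (c + d p p')" by blast
  moreover have "p' \<in> S'" using good_position[OF p'] assms(4) by (auto simp: leaves_def)
  ultimately show ?thesis by blast
qed

section \<open>The strategy and its competitive ratio\<close>

definition parent :: "'a set \<Rightarrow> ('a \<Rightarrow> real) \<Rightarrow> 'a \<Rightarrow> 'a" where
  "parent S h y = arg_min_on (\<lambda>x. h x + d x y) S"

text \<open>The work function after the next request: for finite nonempty \<open>S\<close> this is
  the minimum of \<open>h x + d x y\<close> over \<open>x\<close> in \<open>S\<close>.\<close>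

definition extend :: "'a set \<Rightarrow> ('a \<Rightarrow> real) \<Rightarrow> 'a \<Rightarrow> real" where
  "extend S h y = h (parent S h y) + d (parent S h y) y"

text \<open>A state consists of the last request, the work function on it, the position and the cost so far.\<close>

fun move :: "'a set \<times> ('a \<Rightarrow> real) \<times> 'a \<times> real \<Rightarrow> 'a set \<Rightarrow> 'a set \<times> ('a \<Rightarrow> real) \<times> 'a \<times> real" where
  "move (S, h, p, c) S' =
    (let p' = SOME p'. p' \<in> S' \<and> good (leaves S' (extend S h)) p' (c + d p p')
     in (S', extend S h, p', c + d p p'))"

definition play :: "'a \<Rightarrow> 'a set list \<Rightarrow> 'a set \<times> ('a \<Rightarrow> real) \<times> 'a \<times> real" where
  "play s0 Ss = foldl move ({s0}, \<lambda>_. 0, s0, 0) Ss"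

definition chase :: "'a strategy" where
  "chase s0 Ss = (case play s0 Ss of (S, h, p, c) \<Rightarrow> p)"

text \<open>\<open>good_next\<close> supplies a witness, so the choice by \<open>SOME\<close> in
  \<open>move\<close> meets its specification.\<close>

lemma move_good:
  assumes "good (leaves S h) p c" "finite S" "S \<noteq> {}"
    and "finite S'" "S' \<noteq> {}" "S' \<subseteq> M" "card S' \<le> 3"
  obtains p' where "move (S, h, p, c) S' = (S', extend S h, p', c + d p p')"
    "p' \<in> S'" "good (leaves S' (extend S h)) p' (c + d p p')"
proof -
  have "parent S h ` S' \<subseteq> S"
    unfolding parent_def using arg_min_if_finite(1)[OF assms(2,3)] by blast
  from good_next[OF assms(1,2) this assms(4-7)]
  have "\<exists>p'. p' \<in> S' \<and> good (leaves S' (extend S h)) p' (c + d p p')"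
    unfolding extend_def by blast
  from someI_ex[OF this] show ?thesis
    by (intro that[OF _ conjunct1 conjunct2]) (simp_all only: move.simps Let_def)
qed

lemma extend_le: "finite S \<Longrightarrow> x \<in> S \<Longrightarrow> extend S h y \<le> h x + d x y"
  unfolding extend_def parent_def using arg_min_least[of S x "\<lambda>x. h x + d x y"] by auto

lemma cost_snoc: "cost d s0 (xs @ [x]) = cost d s0 xs + d (last (s0 # xs)) x"
proof -
  have "(s0 # xs @ [x]) ! t = (s0 # xs) ! t" if "t < length xs" for t
    using that by (cases t) (auto simp: nth_append)
  moreover have "(s0 # xs @ [x]) ! length xs = last (s0 # xs)"
    by (simp add: last_conv_nth nth_Cons' nth_append)
  ultimately show ?thesis
    by (simp add: cost_def nth_append)
qed

lemma run_snoc: "run A s0 (Ss @ [S]) = run A s0 Ss @ [A s0 (Ss @ [S])]"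
  by (auto simp: run_def)

lemma last_run_chase:
  "last (s0 # run chase s0 Ss) = chase s0 Ss"
proof (cases Ss rule: rev_cases)
  case Nil
  then show ?thesis by (simp add: run_def chase_def play_def)
next
  case (snoc Ts S)
  then show ?thesis by (simp add: run_snoc)
qed

text \<open>Induction on the prefixes of the request sequence. The last clause is the offline side;
  it propagates by \<open>extend_le\<close>, applied to the last step of a path.\<close>

lemma play_invariant:
  assumes "s0 \<in> M" "requests M 3 Ss"
  obtains S h p where "play s0 Ss = (S, h, p, cost d s0 (run chase s0 Ss))"
    "finite S" "S \<noteq> {}" "good (leaves S h) p (cost d s0 (run chase s0 Ss))"
    "feasible Ss (run chase s0 Ss)"
    "\<And>xs. feasible Ss xs \<Longrightarrow> last (s0 # xs) \<in> S \<and> h (last (s0 # xs)) \<le> cost d s0 xs"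
  using assms(2)
proof (induction Ss arbitrary: thesis rule: rev_induct)
  case Nil
  have "good {#(s0, 0)#} s0 0" using assms(1) by (intro single) auto
  then show ?case
    by (intro Nil(1)[of "{s0}" "\<lambda>_. 0" s0]) (auto simp: play_def run_def cost_def leaves_def feasible_def)
next
  case (snoc S' Ss)
  let ?c = "cost d s0 (run chase s0 Ss)"
  have "requests M 3 Ss" using snoc.prems by (simp add: requests_def)
  then obtain S h p where IH: "play s0 Ss = (S, h, p, ?c)" "finite S" "S \<noteq> {}"
      "good (leaves S h) p ?c" "feasible Ss (run chase s0 Ss)"
      "\<And>xs. feasible Ss xs \<Longrightarrow> last (s0 # xs) \<in> S \<and> h (last (s0 # xs)) \<le> cost d s0 xs"
    using snoc.IH by blast
  have S': "finite S'" "S' \<noteq> {}" "S' \<subseteq> M" "card S' \<le> 3"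
    using snoc.prems(2) by (auto simp: requests_def intro: card_ge_0_finite)
  obtain p' where p': "move (S, h, p, ?c) S' = (S', extend S h, p', ?c + d p p')"
    "p' \<in> S'" "good (leaves S' (extend S h)) p' (?c + d p p')"
    using move_good[OF IH(4,2,3) S'] by blast
  have play: "play s0 (Ss @ [S']) = (S', extend S h, p', ?c + d p p')"
    using IH(1) p'(1) by (simp add: play_def)
  have chase: "chase s0 (Ss @ [S']) = p'" "chase s0 Ss = p"
    using play IH(1) by (simp_all add: chase_def)
  have c: "cost d s0 (run chase s0 (Ss @ [S'])) = ?c + d p p'"
    unfolding run_snoc cost_snoc last_run_chase chase by simp
  show ?case
  proof (rule snoc.prems(1)[of S' "extend S h" p'])
    show "feasible (Ss @ [S']) (run chase s0 (Ss @ [S']))"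
      using IH(5) p'(2) unfolding run_snoc chase feasible_def by (simp add: list_all2_appendI)
    show "last (s0 # xs) \<in> S' \<and> extend S h (last (s0 # xs)) \<le> cost d s0 xs"
      if xs: "feasible (Ss @ [S']) xs" for xs
    proof -
      obtain ys y where y: "xs = ys @ [y]" "feasible Ss ys" "y \<in> S'"
        using xs by (auto simp: feasible_def list_all2_append2 list_all2_Cons2)
      then show ?thesis
        using IH(6)[OF y(2)] extend_le[OF IH(2), of "last (s0 # ys)" h y]
        by (auto simp: cost_snoc)
    qed
  qed (use play c p' S' in auto)
qed

lemma chase_online: "online_algorithm M 3 chase"
  unfolding online_algorithm_def
proof (intro ballI allI impI)
  show "feasible Ss (run chase s0 Ss)" if "s0 \<in> M" "requests M 3 Ss" for s0 Ss
    by (rule play_invariant[OF that])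
qed

text \<open>An optimal path ends at an active leaf whose depth is at most the optimal cost, and
  \<open>good_ratio\<close> applies at that leaf.\<close>

lemma chase_competitive: "competitive M d 3 (21 + 4 * sqrt 5) chase"
  unfolding competitive_def
proof (intro ballI allI impI)
  fix s0 Ss
  assume s0: "s0 \<in> M" and Ss: "requests M 3 Ss"
  let ?c = "cost d s0 (run chase s0 Ss)"
  obtain S h p where S: "finite S" "good (leaves S h) p ?c"
    "\<And>xs. feasible Ss xs \<Longrightarrow> last (s0 # xs) \<in> S \<and> h (last (s0 # xs)) \<le> cost d s0 xs"
    by (rule play_invariant[OF s0 Ss]) blast
  have "opt d s0 Ss \<in> cost d s0 ` {xs. feasible Ss xs}"
    unfolding opt_def using finite_feasible[OF Ss] feasible_nonempty[OF Ss] by (intro Min_in) auto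
  then obtain xs where xs: "feasible Ss xs" "opt d s0 Ss = cost d s0 xs" by auto
  let ?x = "last (s0 # xs)"
  have "(?x, h ?x) \<in># leaves S h"
    using S(1) S(3)[OF xs(1)] by (auto simp: leaves_def)
  from good_ratio[OF S(2) this] have "?c \<le> (21 + 4 * sqrt 5) * h ?x"
    by (simp add: sqrt5_times_def algebra_simps)
  also have "\<dots> \<le> (21 + 4 * sqrt 5) * opt d s0 Ss"
    using S(3)[OF xs(1)] xs(2) by (intro mult_left_mono) auto
  finally show "?c \<le> (21 + 4 * sqrt 5) * opt d s0 Ss" .
qed

end

theorem theorem4:
  fixes M :: "'a set" and d :: "'a \<Rightarrow> 'a \<Rightarrow> real"
  assumes "Metric_space M d"
  shows "D 2 = 9 \<and> D 3 = 2 * D 2 + sqrt (8 + 8 * D 2) + 3 \<and> D 3 = 21 + 4 * sqrt 5 \<and>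
    (\<exists>A. online_algorithm M 3 A \<and> competitive M d 3 (D 3) A)"
proof -
  interpret Metric_space M d by fact
  \<comment> \<open>The radicands in \<open>D 2\<close> and \<open>D 3\<close> are
    \<open>8 + 8 * 1\<close> and \<open>8 + 8 * 9\<close>.\<close>
  have sqrt: "sqrt 16 = 4" "sqrt 80 = 4 * sqrt 5"
    using real_sqrt_mult[of 16 5] by simp_all
  have D2: "D 2 = 9"
    using sqrt by (simp add: numeral_2_eq_2)
  have D3: "D 3 = 2 * D 2 + sqrt (8 + 8 * D 2) + 3"
    by (simp add: numeral_3_eq_3 numeral_2_eq_2)
  then have "D 3 = 21 + 4 * sqrt 5"
    using sqrt unfolding D2 by simp
  then show ?thesis
    using D2 D3 chase_online chase_competitive by auto
qed

end
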